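(* Let $\mathbf{k}$ be a unitary commutative ring, $\lambda\in\mathbf{k}$, and let $(R,D)$ be a differential $\mathbf{k}$-algebra of weight $\lambda$ (not necessarily commutative) with a $\mathbf{k}$-linear operator $\Pi\colon R\to R$ such that $D\circ\Pi=\mathrm{id}_R$. Put $J=\Pi\circ D$ and $E=\mathrm{id}_R-J$. Then the following statements are equivalent: (a) $(R,D,\Pi)$ is an integro-differential algebra of weight $\lambda$; (b) $E(xy)=E(x)E(y)$ for all $x,y\in R$; (c) $\ker E=\operatorname{im}J$ is an ideal of $R$; (d) $J(xJ(y))=xJ(y)$ and $J(J(x)y)=J(x)y$ for all $x,y\in R$; (e) $J(x\Pi(y))=x\Pi(y)$ and $J(\Pi(x)y)=\Pi(x)y$ for all $x,y\in R$; (f) $x\Pi(y)=\Pi(D(x)\Pi(y))+\Pi(xy)+\lambda\Pi(D(x)y)$ and $\Pi(x)y=\Pi(\Pi(x)D(y))+\Pi(xy)+\lambda\Pi(xD(y))$ for all $x,y\in R$; (g) $(R,D,\Pi)$ is a differential Rota-Baxter algebra of weight $\lambda$, and $\Pi(E(x)y)=E(x)\Pi(y)$ and $\Pi(xE(y))=\Pi(x)E(y)$ for all $x,y\in R$; (h) $(R,D,\Pi)$ is a differential Rota-Baxter algebra of weight $\lambda$, and $J(E(x)J(y))=E(x)J(y)$ and $J(J(x)E(y))=J(x)E(y)$ for all $x,y\in R$.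
   Context: A differential $\mathbf{k}$-algebra of weight $\lambda$ is a unitary associative $\mathbf{k}$-algebra $R$ with a $\mathbf{k}$-linear operator $D\colon R\to R$ such that $D(xy)=D(x)y+xD(y)+\lambda D(x)D(y)$ for all $x,y\in R$ and $D(1)=0$. A Rota-Baxter operator of weight $\lambda$ on $R$ is a $\mathbf{k}$-linear operator $P$ with $P(x)P(y)=P(xP(y))+P(P(x)y)+\lambda P(xy)$ for all $x,y\in R$. A differential Rota-Baxter algebra of weight $\lambda$ is a differential algebra $(R,D)$ of weight $\lambda$ with a Rota-Baxter operator $P$ of weight $\lambda$ such that $D\circ P=\mathrm{id}_R$. An integro-differential algebra of weight $\lambda$ is a differential algebra $(R,D)$ of weight $\lambda$ with a $\mathbf{k}$-linear operator $\Pi\colon R\to R$ such that $D\circ\Pi=\mathrm{id}_R$ and $\Pi(D(x))\Pi(D(y))=\Pi(D(x))y+x\Pi(D(y))-\Pi(D(xy))$ for all $x,y\in R$. *)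

theory Defs
  imports "HOL-Algebra.Ideal" "HOL-Algebra.Module"
begin

text \<open>
  The library locale \<^locale>\<open>algebra\<close> requires the algebra to be commutative. The locale below
  drops this, so both one-sided compatibility laws of scalars and products are needed.
  Neither \<^term>\<open>K\<close> nor \<^term>\<open>R\<close> is required to be nonzero.
\<close>

locale assoc_algebra = module K R + ring R for K and R (structure) +
  assumes smult_mult_left:
      "\<lbrakk>a \<in> carrier K; x \<in> carrier R; y \<in> carrier R\<rbrakk>
        \<Longrightarrow> (a \<odot> x) \<otimes> y = a \<odot> (x \<otimes> y)"
    and smult_mult_right:
      "\<lbrakk>a \<in> carrier K; x \<in> carrier R; y \<in> carrier R\<rbrakk>
        \<Longrightarrow> x \<otimes> (a \<odot> y) = a \<odot> (x \<otimes> y)"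

definition linear_operator ::
  "('k, 'c) ring_scheme \<Rightarrow> ('k, 'a, 'b) module_scheme \<Rightarrow> ('a \<Rightarrow> 'a) \<Rightarrow> bool"
  where "linear_operator K R f \<longleftrightarrow>
    f \<in> carrier R \<rightarrow> carrier R \<and>
    (\<forall>x\<in>carrier R. \<forall>y\<in>carrier R. f (x \<oplus>\<^bsub>R\<^esub> y) = f x \<oplus>\<^bsub>R\<^esub> f y) \<and>
    (\<forall>a\<in>carrier K. \<forall>x\<in>carrier R. f (a \<odot>\<^bsub>R\<^esub> x) = a \<odot>\<^bsub>R\<^esub> f x)"

locale differential_algebra = assoc_algebra K R for K and R (structure) +
  fixes lam and D
  assumes weight_closed: "lam \<in> carrier K"
    and D_linear: "linear_operator K R D"
    and D_mult: "\<lbrakk>x \<in> carrier R; y \<in> carrier R\<rbrakk>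
        \<Longrightarrow> D (x \<otimes> y) = D x \<otimes> y \<oplus> x \<otimes> D y \<oplus> lam \<odot> (D x \<otimes> D y)"
    and D_one: "D \<one> = \<zero>"

locale rota_baxter_algebra = assoc_algebra K R for K and R (structure) +
  fixes lam and P
  assumes rb_weight_closed: "lam \<in> carrier K"
    and P_linear: "linear_operator K R P"
    and P_mult: "\<lbrakk>x \<in> carrier R; y \<in> carrier R\<rbrakk>
        \<Longrightarrow> P x \<otimes> P y = P (x \<otimes> P y) \<oplus> P (P x \<otimes> y) \<oplus> lam \<odot> P (x \<otimes> y)"

locale differential_rota_baxter_algebra =
  differential_algebra K R lam D + rota_baxter_algebra K R lam P
  for K and R (structure) and lam and D and P +
  assumes D_P: "x \<in> carrier R \<Longrightarrow> D (P x) = x"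

locale integro_differential_algebra =
  differential_algebra K R lam D
  for K and R (structure) and lam and D +
  fixes P
  assumes int_linear: "linear_operator K R P"
    and D_int: "x \<in> carrier R \<Longrightarrow> D (P x) = x"
    and int_mult: "\<lbrakk>x \<in> carrier R; y \<in> carrier R\<rbrakk>
        \<Longrightarrow> P (D x) \<otimes> P (D y) = P (D x) \<otimes> y \<oplus> x \<otimes> P (D y) \<ominus> P (D (x \<otimes> y))"

end

theory Submission
  imports Defs
begin

text \<open>
  \<open>J = P \<circ> D\<close> is an idempotent operator, so \<open>R\<close> is the direct sum of the subalgebra
  \<open>im E = ker D\<close> of constants and of \<open>I = im J = im P = ker E\<close>. Each of the conditions says that
  \<open>I\<close> is a two-sided ideal: (d) and (e) because \<open>J\<close> fixes exactly \<open>I\<close>; (f) by applying \<open>P\<close> to the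
  product rule; (b) because \<open>E\<close> kills \<open>I\<close> and fixes products of constants, and (a) is (b) with \<open>E\<close>
  expanded; (g) and (h) because the Rota-Baxter axiom says \<open>I I \<subseteq> I\<close>, which leaves the products
  of \<open>I\<close> with constants.
\<close>

section \<open>Linear operators as additive homomorphisms\<close>

context assoc_algebra
begin

lemma
  assumes "linear_operator K R f"
  shows linear_operator_closed: "x \<in> carrier R \<Longrightarrow> f x \<in> carrier R"
    and linear_operator_add:
      "\<lbrakk>x \<in> carrier R; y \<in> carrier R\<rbrakk> \<Longrightarrow> f (x \<oplus> y) = f x \<oplus> f y"
    and linear_operator_smult:
      "\<lbrakk>a \<in> carrier K; x \<in> carrier R\<rbrakk> \<Longrightarrow> f (a \<odot> x) = a \<odot> f x"
  using assms by (auto simp: linear_operator_def)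

text \<open>Forgetting the scalars gives access to the facts on group homomorphisms: preservation of
  zero and of differences, and images being subgroups.\<close>

lemma linear_operator_abelian_group_hom:
  assumes "linear_operator K R f"
  shows "abelian_group_hom R R f"
proof (intro abelian_group_homI group_hom.intro group_hom_axioms.intro)
  show "f \<in> hom (add_monoid R) (add_monoid R)"
    using assms by (auto simp: hom_def linear_operator_def)
qed (rule M.abelian_group_axioms M.a_group)+

lemma linear_operator_zero: "linear_operator K R f \<Longrightarrow> f \<zero> = \<zero>"
  using linear_operator_abelian_group_hom abelian_group_hom.hom_zero by blast

lemma linear_operator_minus:
  assumes f: "linear_operator K R f" and x: "x \<in> carrier R" and y: "y \<in> carrier R"
  shows "f (x \<ominus> y) = f x \<ominus> f y"
proof -
  interpret f: abelian_group_hom R R f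
    using f by (rule linear_operator_abelian_group_hom)
  show ?thesis using x y by (simp add: M.minus_eq)
qed

end

section \<open>Projections attached to a linear section of \<open>D\<close>\<close>

locale differential_algebra_with_section = differential_algebra K R lam D
  for K and R (structure) and lam and D +
  fixes P
  assumes P_linear: "linear_operator K R P"
    and D_P: "x \<in> carrier R \<Longrightarrow> D (P x) = x"
begin

definition "J = P \<circ> D"

text \<open>If \<open>D\<close> is differentiation of functions and \<open>P\<close> is integration
  from a base point, this is evaluation at that point, with values read as constant
  functions.\<close>

definition "E = (\<lambda>x. x \<ominus> J x)"

lemmas D_closed [simp, intro] = linear_operator_closed [OF D_linear]
lemmas P_closed [simp, intro] = linear_operator_closed [OF P_linear]

lemma J_closed [simp, intro]: "x \<in> carrier R \<Longrightarrow> J x \<in> carrier R"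
  by (simp add: J_def)

lemma E_closed [simp, intro]: "x \<in> carrier R \<Longrightarrow> E x \<in> carrier R"
  by (simp add: E_def)

lemma J_linear: "linear_operator K R J"
  using D_linear P_linear unfolding J_def linear_operator_def by (auto simp: Pi_iff)

lemma J_P [simp]: "x \<in> carrier R \<Longrightarrow> J (P x) = P x"
  by (simp add: J_def D_P)

lemma J_J [simp]: "x \<in> carrier R \<Longrightarrow> J (J x) = J x"
  by (simp add: J_def D_P)

lemma D_J [simp]: "x \<in> carrier R \<Longrightarrow> D (J x) = D x"
  by (simp add: J_def D_P)

lemma D_E [simp]: "x \<in> carrier R \<Longrightarrow> D (E x) = \<zero>"
  unfolding E_def by (subst linear_operator_minus [OF D_linear]) (simp_all add: M.minus_eq M.r_neg)

lemma E_plus_J: "x \<in> carrier R \<Longrightarrow> x = E x \<oplus> J x"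
  by (simp add: E_def M.minus_eq M.a_assoc M.l_neg)

lemma E_eq_zero_iff: "x \<in> carrier R \<Longrightarrow> E x = \<zero> \<longleftrightarrow> J x = x"
  by (metis E_def E_plus_J J_closed M.l_zero M.minus_eq M.r_neg)

text \<open>Idempotence of \<open>J\<close> turns membership in its image into an equation, the form
  in which closure under products is checked below.\<close>

lemma in_image_J_iff: "x \<in> J ` carrier R \<longleftrightarrow> x \<in> carrier R \<and> J x = x"
  by (metis J_J J_closed image_iff)

lemma kernel_E: "a_kernel R R E = J ` carrier R"
  unfolding a_kernel_def' using E_eq_zero_iff in_image_J_iff by blast

lemma E_add:
  "\<lbrakk>x \<in> carrier R; y \<in> carrier R\<rbrakk> \<Longrightarrow> E (x \<oplus> y) = E x \<oplus> E y"
  by (simp add: E_def linear_operator_add [OF J_linear] M.minus_eq M.minus_add M.a_ac)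

lemma E_of_constant: "\<lbrakk>c \<in> carrier R; D c = \<zero>\<rbrakk> \<Longrightarrow> E c = c"
  by (simp add: E_def J_def linear_operator_zero [OF P_linear] M.minus_eq)

lemma D_constant_mult:
  assumes "c \<in> carrier R" "y \<in> carrier R" "D c = \<zero>"
  shows "D (c \<otimes> y) = c \<otimes> D y"
  using assms D_mult [of c y] weight_closed by simp

lemma D_mult_constant:
  assumes "x \<in> carrier R" "c \<in> carrier R" "D c = \<zero>"
  shows "D (x \<otimes> c) = D x \<otimes> c"
  using assms D_mult [of x c] weight_closed by simp

text \<open>By the product rule \<open>D\<close> kills a product of constants, and \<open>J\<close>
  vanishes wherever \<open>D\<close> does.\<close>

lemma E_mult_E:
  assumes "x \<in> carrier R" "y \<in> carrier R"
  shows "E (E x \<otimes> E y) = E x \<otimes> E y"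
  using assms by (intro E_of_constant) (simp_all add: D_constant_mult)

lemma J_mult_P:
  assumes "x \<in> carrier R" "y \<in> carrier R"
  shows "J (x \<otimes> P y) = P (D x \<otimes> P y) \<oplus> P (x \<otimes> y) \<oplus> lam \<odot> P (D x \<otimes> y)"
    and "J (P x \<otimes> y) = P (P x \<otimes> D y) \<oplus> P (x \<otimes> y) \<oplus> lam \<odot> P (x \<otimes> D y)"
  using assms weight_closed
  by (simp_all add: J_def D_mult D_P linear_operator_add [OF P_linear]
      linear_operator_smult [OF P_linear] M.a_ac)

section \<open>Equivalences between the conditions\<close>

lemma J_mult_P_iff:
  "(\<forall>x\<in>carrier R. \<forall>y\<in>carrier R. J (x \<otimes> P y) = x \<otimes> P y \<and> J (P x \<otimes> y) = P x \<otimes> y) \<longleftrightarrow>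
    (\<forall>x\<in>carrier R. \<forall>y\<in>carrier R.
      x \<otimes> P y = P (D x \<otimes> P y) \<oplus> P (x \<otimes> y) \<oplus> lam \<odot> P (D x \<otimes> y) \<and>
      P x \<otimes> y = P (P x \<otimes> D y) \<oplus> P (x \<otimes> y) \<oplus> lam \<odot> P (x \<otimes> D y))"
  \<comment> \<open>\<open>J_mult_P\<close> expands the equations on the left into those on the
    right read backwards; \<open>eq_commute\<close>, as an ordered rewrite rule, aligns
    them.\<close>
  by (intro ball_cong refl) (simp only: J_mult_P eq_commute)

text \<open>Replacing \<open>x\<close> by \<open>P x\<close> in \<open>J_mult_P\<close> shows that
  the right-hand side of the Rota-Baxter identity is \<open>J (P x \<otimes> P y)\<close>. The
  identity thus says that the image of \<open>P\<close> is closed under products.\<close>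

lemma rota_baxter_iff:
  "differential_rota_baxter_algebra K R lam D P \<longleftrightarrow>
    (\<forall>x\<in>carrier R. \<forall>y\<in>carrier R. J (P x \<otimes> P y) = P x \<otimes> P y)"
  (is "?L \<longleftrightarrow> ?R")
proof -
  have J_eq: "J (P x \<otimes> P y) = P (x \<otimes> P y) \<oplus> P (P x \<otimes> y) \<oplus> lam \<odot> P (x \<otimes> y)"
    if "x \<in> carrier R" "y \<in> carrier R" for x y
    using J_mult_P(1) [of "P x" y] that by (simp add: D_P)
  show ?thesis
  proof
    assume ?L
    then interpret differential_rota_baxter_algebra K R lam D P .
    show ?R using J_eq P_mult by simp
  next
    assume ?R
    then show ?L
      using J_eq P_linear weight_closed by unfold_locales (simp_all add: D_P)
  qed
qed

lemma integro_differential_iff_E_mult: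
  "integro_differential_algebra K R lam D P \<longleftrightarrow>
    (\<forall>x\<in>carrier R. \<forall>y\<in>carrier R. E (x \<otimes> y) = E x \<otimes> E y)"
  (is "?L \<longleftrightarrow> ?R")
proof -
  have "E (x \<otimes> y) = E x \<otimes> E y \<longleftrightarrow>
      J x \<otimes> J y = J x \<otimes> y \<oplus> x \<otimes> J y \<ominus> J (x \<otimes> y)"
    if x: "x \<in> carrier R" and y: "y \<in> carrier R" for x y
  proof -
    \<comment> \<open>\<open>s\<close> is the value that the integro-differential identity
      prescribes for \<open>J x \<otimes> J y\<close>. Both sides of the multiplicativity of
      \<open>E\<close> share all other terms, so cancelling them leaves
      \<open>J x \<otimes> J y = s\<close>.\<close>
    define s where "s = J x \<otimes> y \<oplus> x \<otimes> J y \<ominus> J (x \<otimes> y)"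
    have s: "s \<in> carrier R"
      using x y by (simp add: s_def)
    have "E x \<otimes> E y = x \<otimes> y \<ominus> (J x \<otimes> y \<oplus> x \<otimes> J y) \<oplus> J x \<otimes> J y"
      using x y
      by (simp add: E_def M.minus_eq l_distr r_distr l_minus r_minus M.minus_add M.a_ac)
    moreover have "E (x \<otimes> y) = x \<otimes> y \<ominus> (J x \<otimes> y \<oplus> x \<otimes> J y) \<oplus> s"
      using x y
      by (simp add: E_def s_def M.minus_eq M.minus_add M.a_ac M.r_neg M.r_neg1 M.r_neg2)
    ultimately show ?thesis
      using x y s by (auto simp flip: s_def)
  qed
  then have "?R \<longleftrightarrow> (\<forall>x\<in>carrier R. \<forall>y\<in>carrier R.
      J x \<otimes> J y = J x \<otimes> y \<oplus> x \<otimes> J y \<ominus> J (x \<otimes> y))"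
    by simp
  then show ?thesis
    using P_linear D_P differential_algebra_axioms
    by (auto simp: J_def integro_differential_algebra_def integro_differential_algebra_axioms_def)
qed

text \<open>As \<open>E (J x) = \<zero>\<close>, a multiplicative \<open>E\<close> kills every
  product with a factor in the image of \<open>J\<close>. Conversely, if it kills these products,
  only \<open>E x \<otimes> E y\<close> survives in \<open>E (x \<otimes> y)\<close>.\<close>

lemma E_mult_iff_J_mult:
  "(\<forall>x\<in>carrier R. \<forall>y\<in>carrier R. E (x \<otimes> y) = E x \<otimes> E y) \<longleftrightarrow>
    (\<forall>x\<in>carrier R. \<forall>y\<in>carrier R. J (x \<otimes> J y) = x \<otimes> J y \<and> J (J x \<otimes> y) = J x \<otimes> y)"
  (is "?L \<longleftrightarrow> ?R")
proof
  assume L: ?L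
  have "E (J x) = \<zero>" if "x \<in> carrier R" for x
    using that by (simp add: E_eq_zero_iff)
  then show ?R
    using L by (auto simp flip: E_eq_zero_iff)
next
  assume R: ?R
  show ?L
  proof (intro ballI)
    fix x y assume x: "x \<in> carrier R" and y: "y \<in> carrier R"
    \<comment> \<open>\<open>J\<close> fixes \<open>J x \<otimes> y\<close> as a whole, so
      \<open>y\<close> is split only beside \<open>E x\<close>.\<close>
    have "x \<otimes> y = (E x \<oplus> J x) \<otimes> y"
      using x E_plus_J by simp
    also have "\<dots> = E x \<otimes> (E y \<oplus> J y) \<oplus> J x \<otimes> y"
      using x y E_plus_J [of y] by (simp add: l_distr)
    also have "\<dots> = E x \<otimes> E y \<oplus> E x \<otimes> J y \<oplus> J x \<otimes> y"
      using x y by (simp add: r_distr)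
    finally have "E (x \<otimes> y) = E (E x \<otimes> E y) \<oplus> E (E x \<otimes> J y) \<oplus> E (J x \<otimes> y)"
      using x y by (simp add: E_add)
    moreover have "E (E x \<otimes> J y) = \<zero>" "E (J x \<otimes> y) = \<zero>"
      using x y R by (simp_all add: E_eq_zero_iff)
    ultimately show "E (x \<otimes> y) = E x \<otimes> E y"
      using x y by (simp add: E_mult_E)
  qed
qed

text \<open>The kernel is the set of fixed points of \<open>J\<close>, so the equations express
  absorption from both sides; additivity of \<open>J\<close> makes its image a subgroup.\<close>

lemma ideal_kernel_E_iff_J_mult:
  "ideal (a_kernel R R E) R \<longleftrightarrow>
    (\<forall>x\<in>carrier R. \<forall>y\<in>carrier R. J (x \<otimes> J y) = x \<otimes> J y \<and> J (J x \<otimes> y) = J x \<otimes> y)"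
  (is "?L \<longleftrightarrow> ?R")
proof
  assume ?L
  then interpret ideal "a_kernel R R E" R .
  show ?R
    using I_l_closed I_r_closed unfolding kernel_E in_image_J_iff by simp
next
  assume R: ?R
  interpret J: abelian_group_hom R R J
    using J_linear by (rule linear_operator_abelian_group_hom)
  show ?L
    unfolding kernel_E
  proof (rule idealI)
    show "subgroup (J ` carrier R) (add_monoid R)"
      using J.a_group_hom group_hom.img_is_subgroup by fastforce
  next
    fix a x assume "a \<in> J ` carrier R" "x \<in> carrier R"
    then show "x \<otimes> a \<in> J ` carrier R" "a \<otimes> x \<in> J ` carrier R"
      using R unfolding in_image_J_iff by (metis m_closed)+
  qed (rule ring_axioms)
qed

text \<open>Since \<open>P y = J (P y)\<close> and \<open>J y = P (D y)\<close>, each condition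
  consists of instances of the other.\<close>

lemma J_mult_J_iff_P:
  "(\<forall>x\<in>carrier R. \<forall>y\<in>carrier R. J (x \<otimes> J y) = x \<otimes> J y \<and> J (J x \<otimes> y) = J x \<otimes> y) \<longleftrightarrow>
    (\<forall>x\<in>carrier R. \<forall>y\<in>carrier R. J (x \<otimes> P y) = x \<otimes> P y \<and> J (P x \<otimes> y) = P x \<otimes> y)"
  (is "?L \<longleftrightarrow> ?R")
proof
  assume L: ?L
  show ?R
  proof (intro ballI)
    fix x y assume "x \<in> carrier R" "y \<in> carrier R"
    then show "J (x \<otimes> P y) = x \<otimes> P y \<and> J (P x \<otimes> y) = P x \<otimes> y"
      using L [rule_format, of x "P y"] L [rule_format, of "P x" y] by simp
  qed
next
  assume ?R
  then show ?L
    by (simp add: J_def)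
qed

text \<open>Splitting the arbitrary factor into its \<open>E\<close> and \<open>J\<close> parts
  leaves two cases: the Rota-Baxter identity covers products of two elements of the image of
  \<open>J\<close>, the second conjunct those with a constant factor.\<close>

lemma J_mult_iff_rota_baxter:
  "(\<forall>x\<in>carrier R. \<forall>y\<in>carrier R. J (x \<otimes> J y) = x \<otimes> J y \<and> J (J x \<otimes> y) = J x \<otimes> y) \<longleftrightarrow>
    differential_rota_baxter_algebra K R lam D P \<and>
    (\<forall>x\<in>carrier R. \<forall>y\<in>carrier R.
      J (E x \<otimes> J y) = E x \<otimes> J y \<and> J (J x \<otimes> E y) = J x \<otimes> E y)"
  (is "?L \<longleftrightarrow> ?R")
proof
  assume ?L
  then show ?R
    using J_mult_J_iff_P unfolding rota_baxter_iff by simp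
next
  assume R: ?R
  have JJ: "J (J x \<otimes> J y) = J x \<otimes> J y" if "x \<in> carrier R" "y \<in> carrier R" for x y
    using R that unfolding rota_baxter_iff by (simp add: J_def)
  show ?L
  proof (intro ballI conjI)
    fix x y assume x: "x \<in> carrier R" and y: "y \<in> carrier R"
    have "x \<otimes> J y = (E x \<oplus> J x) \<otimes> J y"
      using x E_plus_J by simp
    then have "x \<otimes> J y = E x \<otimes> J y \<oplus> J x \<otimes> J y"
      using x y by (simp add: l_distr)
    then show "J (x \<otimes> J y) = x \<otimes> J y"
      using x y R JJ by (simp add: linear_operator_add [OF J_linear])
    have "J x \<otimes> y = J x \<otimes> (E y \<oplus> J y)"
      using y E_plus_J by simp
    then have "J x \<otimes> y = J x \<otimes> E y \<oplus> J x \<otimes> J y"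
      using x y by (simp add: r_distr)
    then show "J (J x \<otimes> y) = J x \<otimes> y"
      using x y R JJ by (simp add: linear_operator_add [OF J_linear])
  qed
qed

text \<open>\<open>D\<close> passes across the constant \<open>E x\<close>, so
  \<open>J (E x \<otimes> y) = P (E x \<otimes> D y)\<close>. Putting \<open>D y\<close> for
  \<open>y\<close> in the condition on \<open>P\<close> gives the one on \<open>J\<close>; putting
  \<open>P y\<close> for \<open>y\<close> in the latter leads back. The other side is
  symmetric.\<close>

lemma P_E_mult_iff_J_E_mult:
  "(\<forall>x\<in>carrier R. \<forall>y\<in>carrier R.
      P (E x \<otimes> y) = E x \<otimes> P y \<and> P (x \<otimes> E y) = P x \<otimes> E y) \<longleftrightarrow>
    (\<forall>x\<in>carrier R. \<forall>y\<in>carrier R.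
      J (E x \<otimes> J y) = E x \<otimes> J y \<and> J (J x \<otimes> E y) = J x \<otimes> E y)"
  (is "?L \<longleftrightarrow> ?R")
proof -
  have J_E: "J (E x \<otimes> y) = P (E x \<otimes> D y)" "J (y \<otimes> E x) = P (D y \<otimes> E x)"
    if "x \<in> carrier R" "y \<in> carrier R" for x y
    using that by (simp_all add: J_def D_constant_mult D_mult_constant)
  show ?thesis
  proof
    assume ?L
    then show ?R
      \<comment> \<open>\<open>J\<close> is unfolded only in the second call, so that
        \<open>J_E\<close> can first match its outer occurrence.\<close>
      by (simp add: J_E) (simp add: J_def)
  next
    assume R: ?R
    show ?L
    proof (intro ballI conjI)
      fix x y assume x: "x \<in> carrier R" and y: "y \<in> carrier R"
      show "P (E x \<otimes> y) = E x \<otimes> P y"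
        using R x y J_E(1) [of x "P y"] by (metis D_P J_P P_closed)
      show "P (x \<otimes> E y) = P x \<otimes> E y"
        using R x y J_E(2) [of y "P x"] by (metis D_P J_P P_closed)
    qed
  qed
qed

end

section \<open>Assembly of the equivalences\<close>

theorem theorem2p5:
  fixes K :: "('k, 'c) ring_scheme"
    and R :: "('k, 'a, 'b) module_scheme" (structure)
    and lam :: 'k
    and D P J E :: "'a \<Rightarrow> 'a"
  assumes "differential_algebra K R lam D"
    and "linear_operator K R P"
    and "\<And>x. x \<in> carrier R \<Longrightarrow> D (P x) = x"
    and "J = P \<circ> D"
    and "E = (\<lambda>x. x \<ominus> J x)"
  shows "a_kernel R R E = J ` carrier R \<and>
    (let
      st_a =
        (integro_differential_algebra K R lam D P);
      st_b =
        (\<forall>x\<in>carrier R. \<forall>y\<in>carrier R. E (x \<otimes> y) = E x \<otimes> E y);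
      st_c =
        (ideal (a_kernel R R E) R);
      st_d =
        (\<forall>x\<in>carrier R. \<forall>y\<in>carrier R. J (x \<otimes> J y) = x \<otimes> J y \<and>
          J (J x \<otimes> y) = J x \<otimes> y);
      st_e =
        (\<forall>x\<in>carrier R. \<forall>y\<in>carrier R. J (x \<otimes> P y) = x \<otimes> P y \<and>
          J (P x \<otimes> y) = P x \<otimes> y);
      st_f =
        (\<forall>x\<in>carrier R. \<forall>y\<in>carrier R. x \<otimes> P y = P (D x \<otimes> P y) \<oplus> P (x \<otimes> y) \<oplus> lam \<odot> P (D x \<otimes> y) \<and>
          P x \<otimes> y = P (P x \<otimes> D y) \<oplus> P (x \<otimes> y) \<oplus> lam \<odot> P (x \<otimes> D y));
      st_g =
        (differential_rota_baxter_algebra K R lam D P \<and>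
        (\<forall>x\<in>carrier R. \<forall>y\<in>carrier R. P (E x \<otimes> y) = E x \<otimes> P y \<and>
          P (x \<otimes> E y) = P x \<otimes> E y));
      st_h =
        (differential_rota_baxter_algebra K R lam D P \<and>
        (\<forall>x\<in>carrier R. \<forall>y\<in>carrier R. J (E x \<otimes> J y) = E x \<otimes> J y \<and>
          J (J x \<otimes> E y) = J x \<otimes> E y))
    in (st_a \<longleftrightarrow> st_b) \<and> (st_a \<longleftrightarrow> st_c) \<and> (st_a \<longleftrightarrow> st_d) \<and>
       (st_a \<longleftrightarrow> st_e) \<and> (st_a \<longleftrightarrow> st_f) \<and> (st_a \<longleftrightarrow> st_g) \<and> (st_a \<longleftrightarrow> st_h))"
proof -
  interpret differential_algebra_with_section K R lam D P
    using assms(1-3)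
    by (simp add: differential_algebra_with_section_def differential_algebra_with_section_axioms_def)
  have J: "J = local.J" and E: "E = local.E"
    using assms(4,5) by (simp_all add: J_def E_def)
  show ?thesis
    unfolding J E Let_def
    \<comment> \<open>Every condition is rewritten to (d): (a) through (b), (f) through (e), and (g)
      through (h).\<close>
    by (intro conjI kernel_E)
      (simp_all only: integro_differential_iff_E_mult E_mult_iff_J_mult ideal_kernel_E_iff_J_mult
        J_mult_J_iff_P [symmetric] J_mult_P_iff [symmetric] P_E_mult_iff_J_E_mult
        J_mult_iff_rota_baxter [symmetric])
qed

end
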